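(* Let $m,n$ be positive integers. For all positive integers $w,h$, \[ \#R(w,h)=N(h+w-1,h)=\frac{1}{h+w-1}\binom{h+w-1}{h-1}\binom{h+w-1}{w-1}, \] and \[ \#\mathbb{I}_{m,n}=\sum_{w=1}^{m}\sum_{h=1}^{n}\frac{(m-w+1)(n-h+1)}{h+w-1}\binom{h+w-1}{h-1}\binom{h+w-1}{w-1}. \]
   Context: $\vec{G}_{m,n}$ is the quiver with vertices $(i,j)$, $1\le i\le m$, $1\le j\le n$, and arrows $(i,j)\to(i+1,j)$, $(i,j)\to(i,j+1)$ whenever both ends are vertices (with full commutativity relations). $\mathbb{I}_{m,n}$ is the set of all nonempty interval subquivers of $\vec{G}_{m,n}$, i.e. nonempty full subquivers that are convex (for vertices $x,y$ of the subquiver, every path in the grid from $x$ to $y$ has all its vertices in the subquiver) and connected as undirected graphs. Each $I\in\mathbb{I}_{m,n}$ is identified with a staircase $\{[b_j,d_j]_j\mid s\le j\le t\}$, where $1\le s\le t\le n$, $1\le b_j\le d_j\le m$, $b_{j+1}\le b_j\le d_{j+1}\le d_j$ for $s\le j<t$, and the vertices of $I$ are the $(i,j)$ with $s\le j\le t$, $b_j\le i\le d_j$. The size of such an $I$ is $\operatorname{Size}(I):=(d_s-b_t+1,\;t-s+1)$. Set $R(w,h):=\{I\in\mathbb{I}_{w,h}\mid\operatorname{Size}(I)=(w,h)\}$. The Narayana number is $N(a,b):=\frac1a\binom{a}{b}\binom{a}{b-1}$ for integers $1\le b\le a$. *)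

theory Defs
  imports Complex_Main "Graph_Theory.Digraph_Component"
begin

type_synonym vertex = "nat \<times> nat"

type_synonym quiver = "(vertex, vertex \<times> vertex) pre_digraph"

text \<open>
  The commutativity relations on the grid quiver are not represented: the notion of an interval
  subquiver only involves the underlying quiver, which has at most one arrow between two vertices.
\<close>

definition grid_vertices :: "nat \<Rightarrow> nat \<Rightarrow> vertex set" where
  "grid_vertices m n = {1..m} \<times> {1..n}"

definition grid :: "nat \<Rightarrow> nat \<Rightarrow> quiver" where
  "grid m n = with_proj
     \<lparr> pverts = grid_vertices m n,
       parcs =
         {((i, j), (i + 1, j)) | i j. (i, j) \<in> grid_vertices m n \<and> (i + 1, j) \<in> grid_vertices m n} \<union>
         {((i, j), (i, j + 1)) | i j. (i, j) \<in> grid_vertices m n \<and> (i, j + 1) \<in> grid_vertices m n} \<rparr>"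

definition convex_subquiver :: "quiver \<Rightarrow> quiver \<Rightarrow> bool" where
  "convex_subquiver H G \<longleftrightarrow>
     (\<forall>x \<in> verts H. \<forall>y \<in> verts H. \<forall>p.
        pre_digraph.awalk G x p y \<longrightarrow> set (pre_digraph.awalk_verts G x p) \<subseteq> verts H)"

text \<open>
  Connectedness is qualified because the name \<open>connected\<close> is also used in topology; the notion
  from \<open>Digraph_Component\<close> is connectedness of the underlying undirected graph.
\<close>

definition intervals :: "nat \<Rightarrow> nat \<Rightarrow> quiver set" where
  "intervals m n =
     {H. induced_subgraph H (grid m n) \<and> verts H \<noteq> {} \<and>
         convex_subquiver H (grid m n) \<and> Digraph_Component.connected H}"

text \<open>
  The staircase data of an interval \<open>H\<close>: \<open>s\<close> and \<open>t\<close> are the first and the last index of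
  a nonempty row, and \<open>b\<^sub>j\<close> and \<open>d\<^sub>j\<close> are the end points of row \<open>j\<close>.
\<close>

definition first_row :: "quiver \<Rightarrow> nat" where
  "first_row H = Min (snd ` verts H)"

definition last_row :: "quiver \<Rightarrow> nat" where
  "last_row H = Max (snd ` verts H)"

definition row_left :: "quiver \<Rightarrow> nat \<Rightarrow> nat" where
  "row_left H j = Min {i. (i, j) \<in> verts H}"

definition row_right :: "quiver \<Rightarrow> nat \<Rightarrow> nat" where
  "row_right H j = Max {i. (i, j) \<in> verts H}"

text \<open>
  In a staircase \<open>b\<^sub>t \<le> b\<^sub>s \<le> d\<^sub>s\<close> and \<open>s \<le> t\<close>, so no subtraction below is truncated.
\<close>

definition interval_size :: "quiver \<Rightarrow> nat \<times> nat" where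
  "interval_size H =
     (row_right H (first_row H) - row_left H (last_row H) + 1, last_row H - first_row H + 1)"

definition staircase :: "nat \<Rightarrow> nat \<Rightarrow> nat \<Rightarrow> nat \<Rightarrow> (nat \<Rightarrow> nat) \<Rightarrow> (nat \<Rightarrow> nat) \<Rightarrow> bool" where
  "staircase m n s t b d \<longleftrightarrow>
     1 \<le> s \<and> s \<le> t \<and> t \<le> n \<and>
     (\<forall>j \<in> {s..t}. 1 \<le> b j \<and> b j \<le> d j \<and> d j \<le> m) \<and>
     (\<forall>j \<in> {s..<t}. b (j + 1) \<le> b j \<and> b j \<le> d (j + 1) \<and> d (j + 1) \<le> d j)"

definition staircase_vertices :: "nat \<Rightarrow> nat \<Rightarrow> (nat \<Rightarrow> nat) \<Rightarrow> (nat \<Rightarrow> nat) \<Rightarrow> vertex set" where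
  "staircase_vertices s t b d = {(i, j). s \<le> j \<and> j \<le> t \<and> b j \<le> i \<and> i \<le> d j}"

lemma interval_size_staircase:
  assumes st: "staircase m n s t b d"
    and H: "verts H = staircase_vertices s t b d"
  shows "interval_size H = (d s - b t + 1, t - s + 1)"
proof -
  have le: "s \<le> t" and bd: "\<And>j. s \<le> j \<Longrightarrow> j \<le> t \<Longrightarrow> b j \<le> d j"
    using st by (auto simp: staircase_def)
  have rows: "snd ` verts H = {s..t}"
    using bd by (force simp: H staircase_vertices_def image_iff)
  have row: "{i. (i, j) \<in> verts H} = {b j..d j}" if "s \<le> j" "j \<le> t" for j
    using that by (auto simp: H staircase_vertices_def)
  have mm: "Min {x..y} = x" "Max {x..y} = y" if "x \<le> y" for x y :: nat
    using that by (auto intro: Min_eqI Max_eqI)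
  show ?thesis
    using le bd
    by (simp add: interval_size_def first_row_def last_row_def row_left_def row_right_def rows row mm)
qed

definition R :: "nat \<Rightarrow> nat \<Rightarrow> quiver set" where
  "R w h = {H \<in> intervals w h. interval_size H = (w, h)}"

definition narayana :: "nat \<Rightarrow> nat \<Rightarrow> real" where
  "narayana a b = 1 / real a * real (a choose b) * real (a choose (b - 1))"

end

theory Submission
  imports Defs
begin

text \<open>
  An interval subquiver is determined by its vertex set, and these vertex sets are exactly the
  staircases (\<open>verts_image_intervals\<close>). A row of an interval is a segment by convexity. Two
  consecutive rows share a column because the quiver is connected, and convexity then forces both
  end points to move weakly to the left from one row to the next.

  A staircase sits in a unique translate of its bounding box, whose measures are its size
  (\<open>place_image\<close>, \<open>inj_on_place\<close>). A box of size \<open>(w, h)\<close> has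
  \<open>(m - w + 1) * (n - h + 1)\<close> positions in the grid, so the total follows once the staircases that
  fill the box \<open>{1..w} \<times> {1..h}\<close> are counted; these are the vertex sets of \<open>R w h\<close>.

  Such a staircase is a parallelogram polyomino: a pair of lattice paths, the left and the right
  boundary, that do not cross. Pairs of non-crossing paths are counted by a two by two determinant
  of numbers of single paths. The proof of this adds one row at a time: the staircases with a
  prescribed top row \<open>[x, y]\<close> satisfy a summation recurrence (\<open>card_stacks_Suc\<close>), and the determinant
  \<open>path_pairs\<close> satisfies the same one, because the boundary terms of its two products cancel
  (\<open>path_pairs_Suc\<close>). Single paths are counted by binomial coefficients, and the determinant for the
  whole box simplifies to the Narayana number (\<open>path_pairs_narayana\<close>).
\<close>

section \<open>Intervals of the grid are staircases\<close>

definition step :: "vertex \<Rightarrow> vertex \<Rightarrow> bool" where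
  "step u v \<longleftrightarrow> v = (fst u + 1, snd u) \<or> v = (fst u, snd u + 1)"

lemma verts_grid [simp]: "verts (grid m n) = grid_vertices m n"
  and tail_grid [simp]: "tail (grid m n) = fst"
  and head_grid [simp]: "head (grid m n) = snd"
  by (simp_all add: grid_def)

lemma arcs_grid:
  "arcs (grid m n) = {(u, v). step u v \<and> u \<in> grid_vertices m n \<and> v \<in> grid_vertices m n}"
  by (auto simp: grid_def step_def)

lemma wf_grid: "wf_digraph (grid m n)"
  by unfold_locales (auto simp: arcs_grid)

lemma grid_walk_between:
  assumes "pre_digraph.awalk (grid m n) u p v"
    and "z \<in> set (pre_digraph.awalk_verts (grid m n) u p)"
  shows "fst u \<le> fst z \<and> snd u \<le> snd z \<and> fst z \<le> fst v \<and> snd z \<le> snd v"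
proof -
  note [simp] = pre_digraph.cas.simps pre_digraph.awalk_verts.simps
  have mono: "fst a \<le> fst c \<and> snd a \<le> snd c"
    if "set q \<subseteq> arcs (grid m n)" "pre_digraph.cas (grid m n) a q c" for a q c
    using that by (induction q arbitrary: a) (fastforce simp: arcs_grid step_def)+
  have "set p \<subseteq> arcs (grid m n)" "pre_digraph.cas (grid m n) u p v"
    using assms(1) by (auto simp: pre_digraph.awalk_def)
  then show ?thesis using assms(2)
  proof (induction p arbitrary: u)
    case (Cons e p)
    have e: "step u (snd e)" "fst e = u" using Cons.prems by (auto simp: arcs_grid)
    consider "z = u" | "z \<in> set (pre_digraph.awalk_verts (grid m n) (snd e) p)"
      using Cons.prems e by auto
    then show ?case
    proof cases
      case 1
      then show ?thesis using mono[OF Cons.prems(1,2)] by simp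
    next
      case 2
      then show ?thesis using Cons.IH[of "snd e"] Cons.prems e(1) by (auto simp: step_def)
    qed
  qed simp
qed

text \<open>
  Going right first and then up stays inside the grid, which is a product of two segments.
\<close>

lemma grid_walk_exists:
  assumes u: "u \<in> grid_vertices m n" and v: "v \<in> grid_vertices m n"
    and le: "fst u \<le> fst v" "snd u \<le> snd v"
  shows "\<exists>p. pre_digraph.awalk (grid m n) u p v"
proof -
  interpret wf_digraph "grid m n" by (rule wf_grid)
  have adj: "a \<rightarrow>\<^bsub>grid m n\<^esub> c"
    if "step a c" "a \<in> grid_vertices m n" "c \<in> grid_vertices m n" for a c
    using that by (auto simp: arcs_ends_conv arcs_grid intro!: image_eqI[where x = "(a, c)"])
  have "u \<rightarrow>\<^sup>*\<^bsub>grid m n\<^esub> (fst u + k, snd u)" if "fst u + k \<le> fst v" for k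
    using that
  proof (induction k)
    case (Suc k)
    have "(fst u + k, snd u) \<rightarrow>\<^bsub>grid m n\<^esub> (fst u + Suc k, snd u)"
      using u v Suc.prems by (intro adj) (auto simp: step_def grid_vertices_def)
    then show ?case using Suc by (auto intro: reachable_adj_trans)
  qed (use u in simp)
  from this[of "fst v - fst u"] have 1: "u \<rightarrow>\<^sup>*\<^bsub>grid m n\<^esub> (fst v, snd u)" using le by simp
  have "(fst v, snd u) \<rightarrow>\<^sup>*\<^bsub>grid m n\<^esub> (fst v, snd u + k)" if "snd u + k \<le> snd v" for k
    using that
  proof (induction k)
    case (Suc k)
    have "(fst v, snd u + k) \<rightarrow>\<^bsub>grid m n\<^esub> (fst v, snd u + Suc k)"
      using u v Suc.prems by (intro adj) (auto simp: step_def grid_vertices_def)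
    then show ?case using Suc by (auto intro: reachable_adj_trans)
  qed (use u v in \<open>auto simp: grid_vertices_def\<close>)
  from this[of "snd v - snd u"] have 2: "(fst v, snd u) \<rightarrow>\<^sup>*\<^bsub>grid m n\<^esub> v" using le by simp
  show ?thesis using reachable_trans[OF 1 2] by (simp add: reachable_awalk)
qed

text \<open>
  The vertices on walks from \<open>u\<close> to \<open>v\<close> are exactly the vertices between them in the product order,
  so convexity is a statement about the order alone, and walks can be forgotten from here on.
\<close>

lemma convex_subquiver_grid_iff:
  assumes V: "verts H \<subseteq> grid_vertices m n"
  shows "convex_subquiver H (grid m n) \<longleftrightarrow>
    (\<forall>u \<in> verts H. \<forall>v \<in> verts H. \<forall>i j.
       fst u \<le> i \<and> i \<le> fst v \<and> snd u \<le> j \<and> j \<le> snd v \<longrightarrow> (i, j) \<in> verts H)"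
    (is "_ \<longleftrightarrow> ?order_convex")
proof
  interpret wf_digraph "grid m n" by (rule wf_grid)
  assume conv: "convex_subquiver H (grid m n)"
  show ?order_convex
  proof (intro ballI allI impI)
    fix u v i j
    assume uv: "u \<in> verts H" "v \<in> verts H"
      and ij: "fst u \<le> i \<and> i \<le> fst v \<and> snd u \<le> j \<and> j \<le> snd v"
    have g: "u \<in> grid_vertices m n" "v \<in> grid_vertices m n" "(i, j) \<in> grid_vertices m n"
      using uv V ij by (fastforce simp: grid_vertices_def)+
    obtain p q where p: "awalk u p (i, j)" and q: "awalk (i, j) q v"
      using grid_walk_exists[OF g(1,3)] grid_walk_exists[OF g(3,2)] ij by auto
    have "awlast u p = (i, j)" using p by (rule awalkE)
    then have "(i, j) \<in> set (awalk_verts u (p @ q))"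
      using set_awalk_verts_append[OF p q] last_in_set[OF awalk_verts_non_Nil, of u p] by simp
    then show "(i, j) \<in> verts H"
      using conv uv awalk_appendI[OF p q] unfolding convex_subquiver_def by blast
  qed
next
  assume conv: ?order_convex
  show "convex_subquiver H (grid m n)"
    unfolding convex_subquiver_def
  proof (intro ballI allI impI subsetI)
    fix u v p z
    assume uv: "u \<in> verts H" "v \<in> verts H" "pre_digraph.awalk (grid m n) u p v"
      "z \<in> set (pre_digraph.awalk_verts (grid m n) u p)"
    show "z \<in> verts H"
      using conv[rule_format, OF uv(1,2), of "fst z" "snd z"] grid_walk_between[OF uv(3,4)] by simp
  qed
qed

lemma induced_subgraph_grid_unique:
  assumes "induced_subgraph H (grid m n)" "induced_subgraph H' (grid m n)" "verts H = verts H'"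
  shows "H = H'"
  using assms by (auto simp: induced_subgraph_def subgraph_def compatible_def intro!: pre_digraph.equality)

lemma adjacent_in_induced_subgraph:
  assumes "induced_subgraph H (grid m n)"
  shows "(u, v) \<in> parcs (mk_symmetric H) \<longleftrightarrow> u \<in> verts H \<and> v \<in> verts H \<and> (step u v \<or> step v u)"
proof -
  have "arcs H = {(a, c). step a c \<and> a \<in> verts H \<and> c \<in> verts H}" "tail H = fst" "head H = snd"
    using assms by (auto simp: induced_subgraph_def subgraph_def compatible_def arcs_grid)
  then show ?thesis by (cases u; cases v) (auto simp: parcs_mk_symmetric)
qed

text \<open>
  This is the form in which connectedness is used: no predicate can separate the vertices without
  an arrow between its two sides.
\<close>

lemma connected_crossing:
  assumes H: "induced_subgraph H (grid m n)" and con: "Digraph_Component.connected H"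
    and u: "u \<in> verts H" "P u" and v: "v \<in> verts H" "\<not> P v"
  obtains a c where "a \<in> verts H" "P a" "c \<in> verts H" "\<not> P c" "step a c \<or> step c a"
proof -
  have reach: "(u, v) \<in> rtrancl_on (verts H) (parcs (mk_symmetric H))"
    using con u v by (auto simp: connected_def strongly_connected_def reachable_def)
  have "\<exists>a c. a \<in> verts H \<and> P a \<and> c \<in> verts H \<and> \<not> P c \<and> (step a c \<or> step c a)"
  proof (rule ccontr)
    assume no: "\<not> ?thesis"
    from reach have "P v"
      by (induction rule: rtrancl_on_induct)
         (use no u in \<open>auto simp: adjacent_in_induced_subgraph[OF H]\<close>)
    with v show False by simp
  qed
  then show ?thesis using that by blast
qed

lemma staircase_antitone:
  assumes "staircase m n s t b d" "s \<le> i" "i \<le> j" "j \<le> t"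
  shows "b j \<le> b i" "d j \<le> d i"
proof -
  from assms(3,4) have "b j \<le> b i \<and> d j \<le> d i"
  proof (induction j rule: dec_induct)
    case (step j)
    then have "j \<in> {s..<t}" using assms by auto
    then have "b (j + 1) \<le> b j \<and> d (j + 1) \<le> d j" using assms(1) unfolding staircase_def by blast
    then show ?case using step by auto
  qed simp
  then show "b j \<le> b i" "d j \<le> d i" by auto
qed

text \<open>
  Each row is a path, so it suffices to link the left end of every row to the one below it. The
  condition \<open>b j \<le> d (j + 1)\<close> says that the vertex above \<open>(b j, j)\<close> belongs to row \<open>j + 1\<close>, and from
  there one walks left along that row.
\<close>

lemma connected_staircase:
  assumes st: "staircase m n s t b d" and H: "induced_subgraph H (grid m n)"
    and V: "verts H = staircase_vertices s t b d"
  shows "Digraph_Component.connected H"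
proof -
  let ?S = "with_proj (mk_symmetric H)"
  interpret H: wf_digraph H using H by (auto simp: induced_subgraph_def subgraph_def)
  interpret S: pair_wf_digraph "mk_symmetric H" by (rule H.wellformed_mk_symmetric)
  have adj: "(u, v) \<in> parcs (mk_symmetric H)" if "u \<in> verts H" "v \<in> verts H" "step u v \<or> step v u" for u v
    using that by (simp add: adjacent_in_induced_subgraph[OF H])
  have sym: "v \<rightarrow>\<^sup>*\<^bsub>?S\<^esub> u" if "u \<rightarrow>\<^sup>*\<^bsub>?S\<^esub> v" for u v
    using that symmetric_mk_symmetric by (rule symmetric_reachable[rotated])
  have row: "(b j, j) \<rightarrow>\<^sup>*\<^bsub>?S\<^esub> (i, j)" if "s \<le> j" "j \<le> t" "b j \<le> i" "i \<le> d j" for i j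
    using that(3,4)
  proof (induction i rule: dec_induct)
    case base
    then show ?case using that by (simp add: V staircase_vertices_def)
  next
    case (step i)
    have "((i, j), (Suc i, j)) \<in> parcs (mk_symmetric H)"
      using step that by (intro adj) (auto simp: V staircase_vertices_def step_def)
    then show ?case using step by (auto intro: S.reachable_adj_trans)
  qed
  have col: "(b s, s) \<rightarrow>\<^sup>*\<^bsub>?S\<^esub> (b j, j)" if "s \<le> j" "j \<le> t" for j
    using that
  proof (induction j rule: dec_induct)
    case base
    then show ?case using st row[of s "b s"] by (auto simp: staircase_def)
  next
    case (step j)
    have "j \<in> {s..<t}" using step by auto
    then have j: "b (j + 1) \<le> b j" "b j \<le> d (j + 1)" "b j \<le> d j"
      using st unfolding staircase_def by fastforce+
    have up: "((b j, j), (b j, j + 1)) \<in> parcs (mk_symmetric H)"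
      using step j by (intro adj) (auto simp: V staircase_vertices_def step_def)
    have left: "(b j, j + 1) \<rightarrow>\<^sup>*\<^bsub>?S\<^esub> (b (j + 1), j + 1)"
      using step j by (intro sym[OF row]) auto
    have "(b s, s) \<rightarrow>\<^sup>*\<^bsub>?S\<^esub> (b j, j)" using step by simp
    from S.reachable_trans[OF S.reachable_adj_trans[OF this up] left]
    show ?case by simp
  qed
  have root: "(b s, s) \<rightarrow>\<^sup>*\<^bsub>?S\<^esub> u" if "u \<in> verts H" for u
    using that col[of "snd u"] row[of "snd u" "fst u"]
    by (auto simp: V staircase_vertices_def intro: S.reachable_trans)
  have "(b s, s) \<in> verts H" using st by (auto simp: V staircase_vertices_def staircase_def)
  moreover have "u \<rightarrow>\<^sup>*\<^bsub>?S\<^esub> v" if "u \<in> verts H" "v \<in> verts H" for u v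
    using S.reachable_trans[OF sym[OF root[OF that(1)]] root[OF that(2)]] .
  ultimately show ?thesis
    by (auto simp: connected_def strongly_connected_def)
qed

text \<open>
  The key is a column \<open>i\<close> common to rows \<open>j\<close> and \<open>j + 1\<close>, obtained from connectedness. It gives
  \<open>b j \<le> i \<le> d (j + 1)\<close> at once. Moreover \<open>(b j, j + 1)\<close> lies between \<open>(b j, j)\<close> and \<open>(i, j + 1)\<close>,
  and \<open>(d (j + 1), j)\<close> lies between \<open>(i, j)\<close> and \<open>(d (j + 1), j + 1)\<close>, so convexity puts both into
  the interval, and these are the two monotonicity conditions.
\<close>

lemma staircase_of_interval:
  assumes "H \<in> intervals m n"
  obtains s t b d where "staircase m n s t b d" "verts H = staircase_vertices s t b d"
proof -
  have H: "induced_subgraph H (grid m n)" and ne: "verts H \<noteq> {}"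
    and con: "Digraph_Component.connected H" and sub: "verts H \<subseteq> grid_vertices m n"
    using assms by (auto simp: intervals_def induced_subgraph_def subgraph_def)
  have conv: "(i, j) \<in> verts H"
    if "(i1, j1) \<in> verts H" "(i2, j2) \<in> verts H" "i1 \<le> i" "i \<le> i2" "j1 \<le> j" "j \<le> j2"
    for i1 j1 i2 j2 i j
  proof -
    have "convex_subquiver H (grid m n)" using assms by (simp add: intervals_def)
    from this[unfolded convex_subquiver_grid_iff[OF sub], rule_format, OF that(1,2), of i j]
    show ?thesis using that(3-) by simp
  qed
  have fin: "finite (verts H)" using sub by (rule finite_subset) (simp add: grid_vertices_def)
  define s t where "s = first_row H" and "t = last_row H"
  define b d where "b = row_left H" and "d = row_right H"
  have sV: "s \<in> snd ` verts H" and tV: "t \<in> snd ` verts H"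
    and st: "\<And>v. v \<in> verts H \<Longrightarrow> s \<le> snd v \<and> snd v \<le> t"
    using fin ne by (auto simp: s_def t_def first_row_def last_row_def)
  have crossing: "\<exists>i. (i, j) \<in> verts H \<and> (i, j + 1) \<in> verts H" if "s \<le> j" "j < t" for j
  proof -
    obtain u v where "u \<in> verts H" "snd u = s" "v \<in> verts H" "snd v = t"
      using sV tV by auto
    then have "u \<in> verts H" "snd u \<le> j" "v \<in> verts H" "\<not> snd v \<le> j"
      using that by auto
    \<comment> \<open>An arrow leaving the rows up to \<open>j\<close> is vertical, so its two ends share their column.\<close>
    then obtain a c where ac: "a \<in> verts H" "snd a \<le> j" "c \<in> verts H" "\<not> snd c \<le> j"
      "step a c \<or> step c a"
      by (rule connected_crossing[OF H con, where P = "\<lambda>v. snd v \<le> j"])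
    then have "a = (fst a, j)" "c = (fst a, j + 1)" by (auto simp: step_def prod_eq_iff)
    then show ?thesis using ac by metis
  qed
  have row_ne: "{i. (i, j) \<in> verts H} \<noteq> {}" if "s \<le> j" "j \<le> t" for j
    using that crossing[of j] tV by (cases "j = t") force+
  have row_fin: "finite {i. (i, j) \<in> verts H}" for j
    by (rule finite_subset[of _ "fst ` verts H"]) (use fin in \<open>force+\<close>)
  have ends: "(b j, j) \<in> verts H" "(d j, j) \<in> verts H" if "s \<le> j" "j \<le> t" for j
    using Min_in[OF row_fin row_ne[OF that]] Max_in[OF row_fin row_ne[OF that]]
    by (auto simp: b_def d_def row_left_def row_right_def)
  have bounds: "b j \<le> i" "i \<le> d j" if "(i, j) \<in> verts H" for i j
    using that row_fin[of j] by (auto simp: b_def d_def row_left_def row_right_def)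
  have "verts H = staircase_vertices s t b d"
  proof (intro equalityI subsetI)
    fix v assume "v \<in> verts H"
    then show "v \<in> staircase_vertices s t b d"
      using st bounds[of "fst v" "snd v"] by (auto simp: staircase_vertices_def)
  next
    fix v assume "v \<in> staircase_vertices s t b d"
    then show "v \<in> verts H"
      using conv[OF ends] by (auto simp: staircase_vertices_def)
  qed
  moreover have "staircase m n s t b d"
    unfolding staircase_def
  proof (intro conjI ballI)
    show "s \<le> t" using sV st by force
    show "1 \<le> s" "t \<le> n" using sV tV sub by (auto simp: grid_vertices_def)
  next
    fix j assume "j \<in> {s..t}"
    then show "1 \<le> b j" "b j \<le> d j" "d j \<le> m"
      using ends[of j] bounds sub by (auto simp: grid_vertices_def)
  next
    fix j assume j: "j \<in> {s..<t}"
    obtain i where i: "(i, j) \<in> verts H" "(i, j + 1) \<in> verts H" using crossing j by auto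
    show "b j \<le> d (j + 1)" using bounds(1)[OF i(1)] bounds(2)[OF i(2)] by simp
    have "(b j, j + 1) \<in> verts H"
      using j bounds(1)[OF i(1)] by (intro conv[OF ends(1)[of j] i(2)]) auto
    then show "b (j + 1) \<le> b j" by (rule bounds)
    have "(d (j + 1), j) \<in> verts H"
      using j bounds(2)[OF i(2)] by (intro conv[OF i(1) ends(2)[of "j + 1"]]) auto
    then show "d (j + 1) \<le> d j" by (rule bounds)
  qed
  ultimately show ?thesis using that by blast
qed

lemma interval_of_staircase:
  assumes st: "staircase m n s t b d"
  obtains H where "H \<in> intervals m n" "verts H = staircase_vertices s t b d"
proof -
  let ?V = "staircase_vertices s t b d"
  let ?H = "grid m n \<restriction> ?V"
  have sub: "?V \<subseteq> grid_vertices m n"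
  proof
    fix v assume "v \<in> ?V"
    then have v: "snd v \<in> {s..t}" "b (snd v) \<le> fst v" "fst v \<le> d (snd v)"
      by (auto simp: staircase_vertices_def)
    then have "1 \<le> b (snd v)" "d (snd v) \<le> m" "1 \<le> s" "t \<le> n"
      using st unfolding staircase_def by blast+
    with v show "v \<in> grid_vertices m n" by (auto simp: grid_vertices_def mem_Times_iff)
  qed
  have ind: "induced_subgraph ?H (grid m n)"
    by (rule wf_digraph.induced_induce[OF wf_grid]) (use sub in simp)
  have "b s \<le> d s" "s \<le> t" using st by (auto simp: staircase_def)
  then have ne: "?V \<noteq> {}" by (auto simp: staircase_vertices_def)
  have order_convex: "(i, j) \<in> ?V"
    if u: "u \<in> ?V" and v: "v \<in> ?V"
      and le: "fst u \<le> i \<and> i \<le> fst v \<and> snd u \<le> j \<and> j \<le> snd v" for u v i j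
  proof -
    have "b j \<le> b (snd u)" "d (snd v) \<le> d j"
      using u v le by (auto simp: staircase_vertices_def intro!: staircase_antitone[OF st])
    then show ?thesis using u v le by (auto simp: staircase_vertices_def)
  qed
  have "verts ?H \<subseteq> grid_vertices m n" using sub by simp
  have "convex_subquiver ?H (grid m n)"
    unfolding convex_subquiver_grid_iff[OF \<open>verts ?H \<subseteq> grid_vertices m n\<close>] induce_subgraph_verts
    by (blast intro: order_convex)
  with ind ne connected_staircase[OF st ind] show ?thesis
    by (intro that[of ?H]) (auto simp: intervals_def)
qed

definition staircase_sets :: "nat \<Rightarrow> nat \<Rightarrow> vertex set set" where
  "staircase_sets m n = {staircase_vertices s t b d | s t b d. staircase m n s t b d}"

lemma inj_on_verts_intervals: "inj_on verts (intervals m n)"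
  by (auto intro!: inj_onI induced_subgraph_grid_unique simp: intervals_def)

lemma verts_image_intervals: "verts ` intervals m n = staircase_sets m n"
proof (intro equalityI subsetI)
  fix V assume "V \<in> verts ` intervals m n"
  then show "V \<in> staircase_sets m n"
    unfolding staircase_sets_def by (auto elim!: staircase_of_interval)
next
  fix V assume "V \<in> staircase_sets m n"
  then obtain s t b d where "staircase m n s t b d" "V = staircase_vertices s t b d"
    by (auto simp: staircase_sets_def)
  then show "V \<in> verts ` intervals m n" by (metis interval_of_staircase image_eqI)
qed

section \<open>Staircases with a prescribed top row\<close>

text \<open>
  The first row must end at \<open>w\<close>, but it may begin anywhere; the last row is \<open>[x, y]\<close>. Prescribing
  both ends of the last row is what makes it possible to put a further row on top.
\<close>

definition stacks :: "nat \<Rightarrow> nat \<Rightarrow> nat \<Rightarrow> nat \<Rightarrow> vertex set set" where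
  "stacks w h x y = {staircase_vertices 1 h b d | b d.
     staircase w h 1 h b d \<and> d 1 = w \<and> b h = x \<and> d h = y}"

lemma stacks_top_row:
  assumes "V \<in> stacks w h x y"
  shows "{i. (i, h) \<in> V} = {x..y}" "x \<le> y" "\<forall>v \<in> V. snd v \<le> h"
  using assms by (auto simp: stacks_def staircase_vertices_def staircase_def)

lemma finite_stacks: "finite (stacks w h x y)"
proof (rule finite_subset)
  have "staircase_vertices 1 h b d \<subseteq> {..w} \<times> {..h}" if "staircase w h 1 h b d" for b d
  proof (clarsimp simp: staircase_vertices_def)
    fix i j assume "Suc 0 \<le> j" "j \<le> h" "i \<le> d j"
    moreover have "d j \<le> w" using calculation that by (simp add: staircase_def)
    ultimately show "i \<le> w" by simp
  qed
  then show "stacks w h x y \<subseteq> Pow ({..w} \<times> {..h})"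
    by (auto simp: stacks_def)
qed simp

lemma stacks_one:
  assumes "1 \<le> x" "x \<le> y" "y \<le> w"
  shows "stacks w 1 x y = (if y = w then {{x..y} \<times> {1}} else {})"
proof -
  have V: "staircase_vertices 1 1 b d = {b 1..d 1} \<times> {1}" for b d
    by (auto simp: staircase_vertices_def)
  have "stacks w 1 x y \<subseteq> {V. V = {x..y} \<times> {1} \<and> y = w}"
    unfolding stacks_def V by auto
  moreover have "{x..y} \<times> {1} \<in> stacks w 1 x y" if "y = w"
  proof -
    have "staircase w 1 1 1 (\<lambda>_. x) (\<lambda>_. y)" using assms by (auto simp: staircase_def)
    then show ?thesis
      unfolding stacks_def V using that
      by (intro CollectI exI[of _ "\<lambda>_. x"] exI[of _ "\<lambda>_. y"]) simp
  qed
  ultimately show ?thesis by (cases "y = w") (simp_all add: subset_singleton_iff, blast)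
qed

text \<open>
  Row \<open>[x, y]\<close> may be put on top of row \<open>[x', y']\<close> exactly if \<open>x \<le> x' \<le> y \<le> y'\<close>. This condition
  separates into one on \<open>x'\<close> and one on \<open>y'\<close>, so the index set is a rectangle.
\<close>

lemma stacks_Suc:
  assumes h: "1 \<le> h" and xy: "1 \<le> x" "x \<le> y" "y \<le> w"
  shows "stacks w (Suc h) x y =
    (\<lambda>V. V \<union> {x..y} \<times> {Suc h}) ` (\<Union>(x', y') \<in> {x..y} \<times> {y..w}. stacks w h x' y')"
    (is "?L = ?add ` ?R")
proof (intro equalityI subsetI)
  fix V assume "V \<in> ?L"
  then obtain b d where st: "staircase w (Suc h) 1 (Suc h) b d"
    and ends: "d 1 = w" "b (Suc h) = x" "d (Suc h) = y"
    and V: "V = staircase_vertices 1 (Suc h) b d"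
    by (auto simp: stacks_def)
  let ?W = "staircase_vertices 1 h b d"
  have st': "staircase w h 1 h b d" using st h by (auto simp: staircase_def)
  then have "?W \<in> stacks w h (b h) (d h)" using ends by (auto simp: stacks_def)
  moreover have "h \<in> {1..<Suc h}" using h by simp
  then have "x \<le> b h" "b h \<le> y" "y \<le> d h"
    using st ends unfolding staircase_def by (metis Suc_eq_plus1)+
  moreover have "d h \<le> w" using st' h unfolding staircase_def by (meson atLeastAtMost_iff order_refl)
  ultimately have "?W \<in> ?R" by fastforce
  moreover have "V = ?add ?W"
    using ends by (auto simp: V staircase_vertices_def le_Suc_eq)
  ultimately show "V \<in> ?add ` ?R" by blast
next
  fix V assume "V \<in> ?add ` ?R"
  then obtain b d where st: "staircase w h 1 h b d" and ends: "d 1 = w"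
    and xy': "x \<le> b h" "b h \<le> y" "y \<le> d h"
    and V: "V = ?add (staircase_vertices 1 h b d)"
    by (auto simp: stacks_def)
  let ?b = "b(Suc h := x)" and ?d = "d(Suc h := y)"
  have "V = staircase_vertices 1 (Suc h) ?b ?d"
    by (auto simp: V staircase_vertices_def)
  moreover have "staircase w (Suc h) 1 (Suc h) ?b ?d"
    unfolding staircase_def
  proof (intro conjI ballI)
    fix j assume "j \<in> {1..Suc h}"
    moreover have "1 \<le> b j \<and> b j \<le> d j \<and> d j \<le> w" if "j \<in> {1..h}"
      using st that unfolding staircase_def by blast
    ultimately have "1 \<le> ?b j \<and> ?b j \<le> ?d j \<and> ?d j \<le> w"
      using xy by (cases "j = Suc h") auto
    then show "1 \<le> ?b j" "?b j \<le> ?d j" "?d j \<le> w" by auto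
  next
    fix j assume "j \<in> {1..<Suc h}"
    moreover have "b (j + 1) \<le> b j \<and> b j \<le> d (j + 1) \<and> d (j + 1) \<le> d j" if "j \<in> {1..<h}"
      using st that unfolding staircase_def by blast
    ultimately have "?b (j + 1) \<le> ?b j \<and> ?b j \<le> ?d (j + 1) \<and> ?d (j + 1) \<le> ?d j"
      using xy' by (cases "j = h") auto
    then show "?b (j + 1) \<le> ?b j" "?b j \<le> ?d (j + 1)" "?d (j + 1) \<le> ?d j" by auto
  qed simp_all
  moreover have "?d 1 = w" "?b (Suc h) = x" "?d (Suc h) = y" using ends h by auto
  ultimately show "V \<in> ?L" unfolding stacks_def by blast
qed

lemma disjoint_stacks:
  assumes "V \<in> stacks w h x y" "V \<in> stacks w h x' y'"
  shows "x = x' \<and> y = y'"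
  using stacks_top_row(1,2)[OF assms(1)] stacks_top_row(1,2)[OF assms(2)]
  by (metis Icc_eq_Icc)

lemma card_UN_stacks:
  assumes "finite I"
  shows "card (\<Union>(x, y) \<in> I. stacks w h x y) = (\<Sum>(x, y) \<in> I. card (stacks w h x y))"
  using assms
  by (subst card_UN_disjoint) (auto simp: finite_stacks split_def dest: disjoint_stacks)

lemma card_stacks_Suc:
  assumes "1 \<le> h" "1 \<le> x" "x \<le> y" "y \<le> w"
  shows "card (stacks w (Suc h) x y) = (\<Sum>x' = x..y. \<Sum>y' = y..w. card (stacks w h x' y'))"
proof -
  let ?U = "\<Union>(x', y') \<in> {x..y} \<times> {y..w}. stacks w h x' y'"
  have "inj_on (\<lambda>V. V \<union> {x..y} \<times> {Suc h}) ?U"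
  proof (rule inj_on_inverseI[where g = "\<lambda>V. {v \<in> V. snd v \<le> h}"])
    fix V assume "V \<in> ?U"
    then have "\<forall>v \<in> V. snd v \<le> h" using stacks_top_row(3) by blast
    then show "{v \<in> V \<union> {x..y} \<times> {Suc h}. snd v \<le> h} = V" by auto
  qed
  then have "card (stacks w (Suc h) x y) = card ?U"
    unfolding stacks_Suc[OF assms] by (rule card_image)
  then show ?thesis by (simp add: card_UN_stacks sum.cartesian_product)
qed

section \<open>Single paths and pairs of non-crossing paths\<close>

text \<open>
  The number of sequences \<open>x = x\<^sub>k \<le> \<dots> \<le> x\<^sub>1 \<le> x\<^sub>0 = w\<close>, which are lattice paths with \<open>k\<close> vertical
  steps. Integers are used because differences of these numbers appear below.
\<close>

fun paths :: "nat \<Rightarrow> nat \<Rightarrow> nat \<Rightarrow> int" where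
  "paths w 0 x = of_bool (x = w)"
| "paths w (Suc k) x = (\<Sum>x' = x..w. paths w k x')"

lemma paths_beyond: "w < x \<Longrightarrow> paths w k x = 0"
  by (cases k) auto

text \<open>
  The recursion of \<open>paths\<close> is the hockey-stick identity \<open>choose_rising_sum\<close>.
\<close>

lemma paths_binomial:
  assumes "x \<le> w"
  shows "paths w (Suc k) x = int ((w - x + k) choose k)"
  using assms
proof (induction k arbitrary: x)
  case 0
  then show ?case by (simp add: of_bool_def)
next
  case (Suc k)
  have "paths w (Suc (Suc k)) x = (\<Sum>x' = x..w. int ((w - x' + k) choose k))"
    using Suc.IH by (simp del: paths.simps(2) add: paths.simps(2)[of w "Suc k"])
  also have "\<dots> = (\<Sum>i \<le> w - x. int ((i + k) choose k))"
    by (rule sum.reindex_bij_witness[of _ "\<lambda>i. w - i" "\<lambda>x'. w - x'"]) (use Suc.prems in auto)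
  also have "\<dots> = int (\<Sum>i \<le> w - x. (k + i) choose k)" by (simp add: add.commute)
  also have "\<dots> = int ((w - x + Suc k) choose Suc k)"
    using choose_rising_sum(1)[of k "w - x"] by (simp add: atLeast0AtMost add.commute)
  finally show ?case .
qed

lemma paths_segment:
  assumes "x \<le> y" "y \<le> w"
  shows "(\<Sum>x' = x..y. paths w k x') = paths w (Suc k) x - paths w (Suc k) (Suc y)"
proof -
  have "{x..w} = {x..y} \<union> {Suc y..w}" using assms by auto
  then have "paths w (Suc k) x = (\<Sum>x' = x..y. paths w k x') + paths w (Suc k) (Suc y)"
    by (simp add: sum.union_disjoint)
  then show ?thesis by simp
qed

lemma paths_shifted_tail:
  "(\<Sum>y' = y..w. paths w k (Suc y')) = paths w (Suc k) (Suc y)"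
proof -
  have "(\<Sum>y' = y..w. paths w k (Suc y')) = (\<Sum>y' = Suc y..Suc w. paths w k y')"
    by (simp only: sum.shift_bounds_cl_Suc_ivl)
  also have "\<dots> = (\<Sum>y' = Suc y..w. paths w k y')"
    by (rule sum.mono_neutral_right) (auto simp: paths_beyond)
  finally show ?thesis by simp
qed

text \<open>
  The determinant of Lindstrom, Gessel and Viennot for the two boundaries of a
  staircase with \<open>k + 1\<close> rows and top row \<open>[x, y]\<close>. Its right ends form a path from \<open>y\<close> to \<open>w\<close> with
  \<open>k\<close> steps; its left ends, with the bound \<open>w\<close> for the left end of the first row, form a path from
  \<open>x\<close> to \<open>w\<close> with \<open>k + 1\<close> steps. The first product counts all pairs of such paths, and
  the second one counts those that cross: exchanging the parts above the topmost crossing, with a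
  shift by one column, turns them into all pairs of a path from \<open>y + 1\<close> with \<open>k + 1\<close> steps and a
  path from \<open>x - 1\<close> with \<open>k\<close> steps. The subtraction is not truncated for \<open>x \<ge> 1\<close>, the only case
  that occurs.
\<close>

definition path_pairs :: "nat \<Rightarrow> nat \<Rightarrow> nat \<Rightarrow> nat \<Rightarrow> int" where
  "path_pairs w k x y =
     paths w k y * paths w (Suc k) x - paths w (Suc k) (Suc y) * paths w k (x - 1)"

text \<open>
  The double sum splits into products of single sums. The sums over \<open>y'\<close> reach \<open>w\<close> and are again
  values of \<open>paths\<close>; the sums over \<open>x'\<close> stop at \<open>y\<close> and leave one boundary term each. Both boundary
  terms contribute the product of \<open>paths w (k + 1) y\<close> and \<open>paths w (k + 2) (y + 1)\<close>, with opposite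
  signs.
\<close>

lemma path_pairs_Suc:
  assumes "1 \<le> x" "x \<le> y" "y \<le> w"
  shows "(\<Sum>x' = x..y. \<Sum>y' = y..w. path_pairs w k x' y') = path_pairs w (Suc k) x y"
proof -
  have "(\<Sum>x' = x..y. \<Sum>y' = y..w. path_pairs w k x' y') =
      (\<Sum>x' = x..y. paths w (Suc k) x') * (\<Sum>y' = y..w. paths w k y')
      - (\<Sum>x' = x..y. paths w k (x' - 1)) * (\<Sum>y' = y..w. paths w (Suc k) (Suc y'))"
    unfolding path_pairs_def sum_subtractf sum_product by (simp only: mult.commute)
  moreover have "(\<Sum>x' = x..y. paths w k (x' - 1)) = (\<Sum>x' = x - 1..y - 1. paths w k x')"
    using sum.shift_bounds_cl_Suc_ivl[of "\<lambda>x'. paths w k (x' - 1)" "x - 1" "y - 1"] assms by simp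
  moreover have "\<dots> = paths w (Suc k) (x - 1) - paths w (Suc k) y"
    using paths_segment[of "x - 1" "y - 1" w k] assms by simp
  moreover have "(\<Sum>x' = x..y. paths w (Suc k) x') =
      paths w (Suc (Suc k)) x - paths w (Suc (Suc k)) (Suc y)"
    using assms by (intro paths_segment)
  moreover have "(\<Sum>y' = y..w. paths w (Suc k) (Suc y')) = paths w (Suc (Suc k)) (Suc y)"
    by (rule paths_shifted_tail)
  moreover have "(\<Sum>y' = y..w. paths w k y') = paths w (Suc k) y"
    by simp
  ultimately show ?thesis
    by (simp only: path_pairs_def) (simp del: paths.simps add: algebra_simps)
qed

text \<open>
  For a single row the determinant is \<open>1\<close> if \<open>y = w\<close>; otherwise both products vanish, since \<open>y\<close> and
  \<open>x - 1\<close> differ from \<open>w\<close>.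
\<close>

lemma card_stacks:
  assumes "1 \<le> x" "x \<le> y" "y \<le> w"
  shows "int (card (stacks w (Suc k) x y)) = path_pairs w k x y"
  using assms
proof (induction k arbitrary: x y)
  case 0
  then show ?case
    using stacks_one[of x y w] by (auto simp: path_pairs_def of_bool_def)
next
  case (Suc k)
  have "int (card (stacks w (Suc (Suc k)) x y)) =
      (\<Sum>x' = x..y. \<Sum>y' = y..w. int (card (stacks w (Suc k) x' y')))"
    using Suc.prems by (simp add: card_stacks_Suc)
  also have "\<dots> = (\<Sum>x' = x..y. \<Sum>y' = y..w. path_pairs w k x' y')"
    using Suc.prems by (intro sum.cong refl Suc.IH) auto
  also have "\<dots> = path_pairs w (Suc k) x y"
    using Suc.prems by (rule path_pairs_Suc)
  finally show ?case .
qed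

text \<open>
  The staircases that fill the box \<open>{1..w} \<times> {1..h}\<close>: the top row begins in column \<open>1\<close>. Restricting
  \<open>x\<close> to the segment \<open>{1..1}\<close> gives the union the shape of the recurrence for \<open>stacks\<close>.
\<close>

definition tight_staircases :: "nat \<Rightarrow> nat \<Rightarrow> vertex set set" where
  "tight_staircases w h = (\<Union>(x, y) \<in> {1..1} \<times> {1..w}. stacks w h x y)"

lemma tight_staircases_iff:
  assumes "1 \<le> h"
  shows "V \<in> tight_staircases w h \<longleftrightarrow>
    (\<exists>b d. staircase w h 1 h b d \<and> d 1 = w \<and> b h = 1 \<and> V = staircase_vertices 1 h b d)"
proof -
  have "1 \<le> d h \<and> d h \<le> w" if "staircase w h 1 h b d" "b h = 1" for b d
  proof -
    have "h \<in> {1..h}" using assms by simp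
    then have "1 \<le> b h \<and> b h \<le> d h \<and> d h \<le> w"
      using that(1) unfolding staircase_def by blast
    then show ?thesis by linarith
  qed
  then show ?thesis by (fastforce simp: tight_staircases_def stacks_def)
qed

text \<open>
  Summing over all top rows \<open>[1, y]\<close> is the recurrence for one more row \<open>[1, 1]\<close>: each of these
  staircases carries a single extra cell in column \<open>1\<close>.
\<close>

lemma card_tight_staircases:
  assumes "1 \<le> w" "1 \<le> h"
  shows "int (card (tight_staircases w h)) = path_pairs w h 1 1"
proof -
  obtain k where h: "h = Suc k" using assms by (cases h) auto
  have "int (card (tight_staircases w h)) =
      (\<Sum>x = 1..1. \<Sum>y = 1..w. int (card (stacks w h x y)))"
    unfolding tight_staircases_def sum.cartesian_product
    by (subst card_UN_stacks) (simp_all add: case_prod_unfold)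
  also have "\<dots> = (\<Sum>x = 1..1. \<Sum>y = 1..w. path_pairs w k x y)"
    unfolding h by (intro sum.cong refl card_stacks) auto
  also have "\<dots> = path_pairs w h 1 1"
    unfolding h using assms by (intro path_pairs_Suc) auto
  finally show ?thesis .
qed

text \<open>
  With \<open>N = h + w - 1\<close> the determinant is
  \<open>(N - 1 choose h - 1) * (N choose h) - (N choose h - 1) * (N - 1 choose h)\<close>. Multiplying it by \<open>N\<close> and
  absorbing \<open>N\<close> into the binomial coefficients with upper index \<open>N - 1\<close> leaves
  \<open>(N choose h) * (N choose h - 1)\<close>.
\<close>

lemma path_pairs_narayana:
  assumes "1 \<le> w" "1 \<le> h"
  shows "real_of_int (path_pairs w h 1 1) = narayana (h + w - 1) h"
proof -
  obtain k where h: "h = Suc k" using assms by (cases h) auto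
  obtain l where w: "w = Suc l" using assms by (cases w) auto
  define N where "N = Suc (l + k)"
  have P1: "paths w h 1 = int ((l + k) choose k)"
    unfolding h w by (subst paths_binomial) auto
  have P2: "paths w (Suc h) 1 = int (N choose Suc k)"
    unfolding h w N_def by (subst paths_binomial) auto
  have P3: "paths w h (1 - 1) = int (N choose k)"
    unfolding h w N_def by (subst paths_binomial) auto
  \<comment> \<open>For \<open>w = 1\<close> both sides vanish; the formula for \<open>paths\<close> holds only up to \<open>w\<close>.\<close>
  have P4: "paths w (Suc h) (Suc 1) = int ((l + k) choose Suc k)"
  proof (cases l)
    case 0
    then show ?thesis by (simp add: w paths_beyond binomial_eq_0 del: paths.simps)
  next
    case (Suc l')
    then show ?thesis unfolding h w by (subst paths_binomial) auto
  qed
  have N: "h + w - 1 = N" by (simp add: h w N_def)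
  have up: "Suc k * (N choose Suc k) = N * ((l + k) choose k)"
    using binomial_absorption[of k N] by (simp only: N_def diff_Suc_1)
  have pascal: "N choose Suc k = ((l + k) choose k) + ((l + k) choose Suc k)"
    by (simp add: N_def)
  have step: "Suc k * (N choose Suc k) = Suc l * (N choose k)"
    using binomial_absorb_comp[of N k] up by (simp del: binomial_Suc_Suc add: N_def)
  define A B C D where "A = real ((l + k) choose k)" and "B = real (N choose Suc k)"
    and "C = real ((l + k) choose Suc k)" and "D = real (N choose k)"
  have r: "real (Suc k) * B = real N * A" "B = A + C" "real (Suc k) * B = real (Suc l) * D"
    using up pascal step unfolding A_def B_def C_def D_def
    by (simp_all only: of_nat_mult[symmetric] of_nat_add[symmetric] of_nat_eq_iff)
  have NA: "real N * A = (real k + 1) * B" and NC: "real N * C = real l * B"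
    using r(1,2) by (simp_all add: N_def algebra_simps)
  have "real N * (A * B - D * C) = (real N * A) * B - D * (real N * C)"
    by (simp add: algebra_simps)
  also have "\<dots> = B * ((real k + 1) * B - real l * D)"
    unfolding NA NC by (simp add: algebra_simps)
  also have "(real k + 1) * B - real l * D = D"
    using r(3) by (simp add: algebra_simps)
  finally have "A * B - D * C = 1 / real N * B * D"
    by (simp add: N_def field_simps)
  moreover have "real_of_int (path_pairs w h 1 1) = A * B - D * C"
    by (simp only: path_pairs_def P1 P2 P3 P4 A_def B_def C_def D_def) simp
  ultimately show ?thesis
    unfolding N by (simp add: narayana_def B_def D_def h)
qed

section \<open>Positions of the bounding box\<close>

definition shift :: "nat \<Rightarrow> nat \<Rightarrow> vertex set \<Rightarrow> vertex set" where
  "shift x y V = (\<lambda>(i, j). (i + x, j + y)) ` V"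

lemma shift_staircase_vertices:
  "shift x y (staircase_vertices s t b d) =
    staircase_vertices (s + y) (t + y) (\<lambda>j. b (j - y) + x) (\<lambda>j. d (j - y) + x)"
proof (intro equalityI subsetI)
  fix v assume "v \<in> staircase_vertices (s + y) (t + y) (\<lambda>j. b (j - y) + x) (\<lambda>j. d (j - y) + x)"
  then have "(fst v - x, snd v - y) \<in> staircase_vertices s t b d"
    and "v = (fst v - x + x, snd v - y + y)"
    by (auto simp: staircase_vertices_def)
  then show "v \<in> shift x y (staircase_vertices s t b d)"
    unfolding shift_def by (intro image_eqI) auto
qed (auto simp: shift_def staircase_vertices_def)

lemma staircase_shift:
  assumes st: "staircase w h s t b d" and m: "w + x \<le> m" and n: "h + y \<le> n"
  shows "staircase m n (s + y) (t + y) (\<lambda>j. b (j - y) + x) (\<lambda>j. d (j - y) + x)"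
  unfolding staircase_def
proof (intro conjI ballI)
  show "1 \<le> s + y" "s + y \<le> t + y" "t + y \<le> n"
    using st n by (auto simp: staircase_def)
next
  fix j assume "j \<in> {s + y..t + y}"
  then have "j - y \<in> {s..t}" by auto
  then have "1 \<le> b (j - y) \<and> b (j - y) \<le> d (j - y) \<and> d (j - y) \<le> w"
    using st unfolding staircase_def by blast
  then show "1 \<le> b (j - y) + x" "b (j - y) + x \<le> d (j - y) + x" "d (j - y) + x \<le> m"
    using m by auto
next
  fix j assume j: "j \<in> {s + y..<t + y}"
  then have "j - y \<in> {s..<t}" by auto
  then have "b (j - y + 1) \<le> b (j - y) \<and> b (j - y) \<le> d (j - y + 1) \<and> d (j - y + 1) \<le> d (j - y)"
    using st unfolding staircase_def by blast
  moreover have "j + 1 - y = j - y + 1" using j by auto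
  ultimately show "b (j + 1 - y) + x \<le> b (j - y) + x" "b (j - y) + x \<le> d (j + 1 - y) + x"
    "d (j + 1 - y) + x \<le> d (j - y) + x"
    by auto
qed

text \<open>
  Every row lies between the columns \<open>b t\<close> and \<open>d s\<close>, because the end points decrease. Hence moving
  the corner \<open>(b t, s)\<close> of the bounding box to \<open>(1, 1)\<close> does not truncate any subtraction.
\<close>

lemma staircase_unshift:
  assumes st: "staircase m n s t b d"
  defines "x \<equiv> b t - 1" and "y \<equiv> s - 1"
  shows "staircase (d s - b t + 1) (t - s + 1) 1 (t - s + 1) (\<lambda>j. b (j + y) - x) (\<lambda>j. d (j + y) - x)"
proof -
  have s: "1 \<le> s" "s \<le> t" using st by (auto simp: staircase_def)
  have bt: "1 \<le> b t" using st s unfolding staircase_def by auto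
  have row: "b t \<le> b j \<and> b j \<le> d j \<and> d j \<le> d s" if "j \<in> {s..t}" for j
  proof -
    have "b j \<le> d j" using st that unfolding staircase_def by blast
    then show ?thesis using staircase_antitone[OF st] that by auto
  qed
  show ?thesis
    unfolding staircase_def
  proof (intro conjI ballI)
    fix j assume "j \<in> {1..t - s + 1}"
    then have "j + y \<in> {s..t}" using s by (auto simp: y_def)
    from row[OF this] bt
    show "1 \<le> b (j + y) - x" "b (j + y) - x \<le> d (j + y) - x" "d (j + y) - x \<le> d s - b t + 1"
      by (auto simp: x_def)
  next
    fix j assume "j \<in> {1..<t - s + 1}"
    then have "j + y \<in> {s..<t}" using s by (auto simp: y_def)
    then have "b (j + y + 1) \<le> b (j + y) \<and> b (j + y) \<le> d (j + y + 1) \<and> d (j + y + 1) \<le> d (j + y)"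
      using st unfolding staircase_def by blast
    moreover have "j + 1 + y = j + y + 1" by simp
    ultimately show "b (j + 1 + y) - x \<le> b (j + y) - x" "b (j + y) - x \<le> d (j + 1 + y) - x"
      "d (j + 1 + y) - x \<le> d (j + y) - x"
      by (auto intro: diff_le_mono)
  qed (use s in auto)
qed

lemma staircase_vertices_cong:
  assumes "\<And>j. j \<in> {s..t} \<Longrightarrow> b j = b' j \<and> d j = d' j"
  shows "staircase_vertices s t b d = staircase_vertices s t b' d'"
  using assms by (auto simp: staircase_vertices_def)

text \<open>
  The two corner cells lie in opposite corners of the box, so they determine the box; this is
  what makes the position of a staircase unique.
\<close>

lemma tight_staircase_box:
  assumes h: "1 \<le> h" and V: "V \<in> tight_staircases w h"
  shows "V \<subseteq> {1..w} \<times> {1..h}" "(1, h) \<in> V" "(w, 1) \<in> V"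
proof -
  obtain b d where st: "staircase w h 1 h b d" and ends: "d 1 = w" "b h = 1"
    and V: "V = staircase_vertices 1 h b d"
    using V tight_staircases_iff[OF h] by blast
  have row: "1 \<le> b j \<and> b j \<le> d j \<and> d j \<le> w" if "j \<in> {1..h}" for j
    using st that unfolding staircase_def by blast
  show "(1, h) \<in> V" "(w, 1) \<in> V"
    using row[of h] row[of 1] h ends by (auto simp: V staircase_vertices_def)
  show "V \<subseteq> {1..w} \<times> {1..h}"
  proof
    fix v assume "v \<in> V"
    then have v: "snd v \<in> {1..h}" "b (snd v) \<le> fst v" "fst v \<le> d (snd v)"
      by (auto simp: V staircase_vertices_def)
    then show "v \<in> {1..w} \<times> {1..h}" using row[OF v(1)] by (auto simp: mem_Times_iff)
  qed
qed

text \<open>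
  A placement consists of the measures of a box, the displacement of its corner from \<open>(1, 1)\<close>, and a
  staircase that fills the box.
\<close>

definition placements :: "nat \<Rightarrow> nat \<Rightarrow> ((nat \<times> nat) \<times> (nat \<times> nat) \<times> vertex set) set" where
  "placements m n = (SIGMA wh : {1..m} \<times> {1..n}.
     ({0..m - fst wh} \<times> {0..n - snd wh}) \<times> tight_staircases (fst wh) (snd wh))"

definition place :: "(nat \<times> nat) \<times> (nat \<times> nat) \<times> vertex set \<Rightarrow> vertex set" where
  "place = (\<lambda>(_, (x, y), V). shift x y V)"

lemma inj_on_place: "inj_on place (placements m n)"
proof (rule inj_onI)
  fix p p'
  assume P: "p \<in> placements m n" "p' \<in> placements m n" and eq: "place p = place p'"
  obtain w h x y V w' h' x' y' V'
    where p: "p = ((w, h), (x, y), V)" "p' = ((w', h'), (x', y'), V')"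
    by (metis surj_pair)
  have sh: "shift x y V = shift x' y' V'" using eq by (simp add: p place_def)
  have h: "1 \<le> h" "1 \<le> h'" and V: "V \<in> tight_staircases w h" "V' \<in> tight_staircases w' h'"
    using P by (auto simp: p placements_def)
  note box = tight_staircase_box[OF h(1) V(1)] and box' = tight_staircase_box[OF h(2) V(2)]
  have "shift x y V \<subseteq> {1 + x..w + x} \<times> {1 + y..h + y}"
    "shift x' y' V' \<subseteq> {1 + x'..w' + x'} \<times> {1 + y'..h' + y'}"
    using box(1) box'(1) by (auto simp: shift_def)
  moreover have "(1 + x, h + y) \<in> shift x y V" "(w + x, 1 + y) \<in> shift x y V"
    "(1 + x', h' + y') \<in> shift x' y' V'" "(w' + x', 1 + y') \<in> shift x' y' V'"
    using box(2,3) box'(2,3) by (force simp: shift_def)+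
  ultimately have "(1 + x, h + y) \<in> {1 + x'..w' + x'} \<times> {1 + y'..h' + y'}"
    "(w + x, 1 + y) \<in> {1 + x'..w' + x'} \<times> {1 + y'..h' + y'}"
    "(1 + x', h' + y') \<in> {1 + x..w + x} \<times> {1 + y..h + y}"
    "(w' + x', 1 + y') \<in> {1 + x..w + x} \<times> {1 + y..h + y}"
    using sh by blast+
  then have "x = x' \<and> y = y' \<and> w = w' \<and> h = h'" by auto
  moreover have "inj (\<lambda>(i, j). (i + x, j + y))" by (auto intro!: injI)
  ultimately show "p = p'"
    using sh by (simp add: p shift_def inj_image_eq_iff)
qed

lemma place_image: "place ` placements m n = staircase_sets m n"
proof (intro equalityI subsetI)
  fix U assume "U \<in> place ` placements m n"
  then obtain w h x y V where wh: "1 \<le> w" "w \<le> m" "1 \<le> h" "h \<le> n" "x \<le> m - w" "y \<le> n - h"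
    and V: "V \<in> tight_staircases w h" and U: "U = shift x y V"
    by (auto simp: placements_def place_def)
  obtain b d where st: "staircase w h 1 h b d" and "V = staircase_vertices 1 h b d"
    using V tight_staircases_iff[OF wh(3)] by blast
  then have "U = staircase_vertices (1 + y) (h + y) (\<lambda>j. b (j - y) + x) (\<lambda>j. d (j - y) + x)"
    by (simp only: U shift_staircase_vertices)
  moreover have "staircase m n (1 + y) (h + y) (\<lambda>j. b (j - y) + x) (\<lambda>j. d (j - y) + x)"
    using wh by (intro staircase_shift[OF st]) auto
  ultimately show "U \<in> staircase_sets m n" unfolding staircase_sets_def by blast
next
  fix U assume "U \<in> staircase_sets m n"
  then obtain s t b d where st: "staircase m n s t b d" and U: "U = staircase_vertices s t b d"
    by (auto simp: staircase_sets_def)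
  define x y w h where "x = b t - 1" and "y = s - 1" and "w = d s - b t + 1" and "h = t - s + 1"
  let ?b = "\<lambda>j. b (j + y) - x" and ?d = "\<lambda>j. d (j + y) - x"
  have s: "1 \<le> s" "s \<le> t" "t \<le> n" using st by (auto simp: staircase_def)
  have "1 \<le> b j \<and> b j \<le> d j \<and> d j \<le> m" if "j \<in> {s..t}" for j
    using st that unfolding staircase_def by blast
  from this[of s] this[of t] have bt: "1 \<le> b t" "b s \<le> d s" "d s \<le> m" using s by auto
  have anti: "b t \<le> b j \<and> b t \<le> d j" if "j \<in> {s..t}" for j
  proof -
    have "b j \<le> d j" using st that unfolding staircase_def by blast
    then show ?thesis using staircase_antitone(1)[OF st, of j t] that by auto
  qed
  have ts: "staircase w h 1 h ?b ?d"
    using staircase_unshift[OF st] by (simp only: x_def y_def w_def h_def)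
  have sy: "1 + y = s" "h + y = t" using s by (auto simp: y_def h_def)
  have "?d 1 = w" unfolding sy w_def x_def using anti[of s] bt s by auto
  moreover have "?b h = 1" using sy bt by (simp add: x_def)
  moreover have "1 \<le> h" by (simp add: h_def)
  ultimately have V: "staircase_vertices 1 h ?b ?d \<in> tight_staircases w h"
    using ts tight_staircases_iff by blast
  have "shift x y (staircase_vertices 1 h ?b ?d) = U"
    unfolding U shift_staircase_vertices sy
  proof (rule staircase_vertices_cong)
    fix j assume j: "j \<in> {s..t}"
    then show "b (j - y + y) - x + x = b j \<and> d (j - y + y) - x + x = d j"
      using anti[OF j] s by (auto simp: x_def y_def)
  qed
  then have "U = place ((w, h), (x, y), staircase_vertices 1 h ?b ?d)"
    by (simp add: place_def)
  moreover have "((w, h), (x, y), staircase_vertices 1 h ?b ?d) \<in> placements m n"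
    using V bt s anti[of s] by (auto simp: placements_def w_def h_def x_def y_def)
  ultimately show "U \<in> place ` placements m n" by (rule image_eqI)
qed

lemma card_staircase_sets:
  "card (staircase_sets m n) =
    (\<Sum>w = 1..m. \<Sum>h = 1..n. (m - w + 1) * (n - h + 1) * card (tight_staircases w h))"
proof -
  have fin: "finite (tight_staircases w h)" for w h
    by (auto simp: tight_staircases_def finite_stacks)
  have "card (staircase_sets m n) = card (placements m n)"
    unfolding place_image[symmetric] using inj_on_place by (rule card_image)
  also have "\<dots> = (\<Sum>wh \<in> {1..m} \<times> {1..n}.
      card (({0..m - fst wh} \<times> {0..n - snd wh}) \<times> tight_staircases (fst wh) (snd wh)))"
    unfolding placements_def by (rule card_SigmaI) (auto simp: fin)
  also have "\<dots> = (\<Sum>w = 1..m. \<Sum>h = 1..n. (m - w + 1) * (n - h + 1) * card (tight_staircases w h))"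
    unfolding sum.cartesian_product by (simp add: card_cartesian_product case_prod_unfold)
  finally show ?thesis .
qed


section \<open>The Narayana count\<close>

text \<open>
  Inside a grid of the same measures as the size of the interval there is no room to move:
  \<open>t - s + 1 = h\<close> forces \<open>s = 1\<close> and \<open>t = h\<close>, and \<open>d s - b t + 1 = w\<close> forces \<open>b t = 1\<close> and \<open>d s = w\<close>.
\<close>

lemma verts_image_R:
  assumes h: "1 \<le> h"
  shows "verts ` R w h = tight_staircases w h"
proof (intro equalityI subsetI)
  fix V assume "V \<in> verts ` R w h"
  then obtain H where H: "H \<in> intervals w h" "interval_size H = (w, h)" and V: "V = verts H"
    by (auto simp: R_def)
  obtain s t b d where st: "staircase w h s t b d" and VH: "verts H = staircase_vertices s t b d"
    using H(1) by (rule staircase_of_interval)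
  have size: "d s - b t + 1 = w" "t - s + 1 = h"
    using H(2) interval_size_staircase[OF st VH] by auto
  have s: "1 \<le> s" "s \<le> t" "t \<le> h" using st by (auto simp: staircase_def)
  then have "s = 1" "t = h" using size by auto
  have "1 \<le> b j \<and> b j \<le> d j \<and> d j \<le> w" if "j \<in> {s..t}" for j
    using st that unfolding staircase_def by blast
  from this[of s] this[of t] have "1 \<le> b t" "b s \<le> d s" "d s \<le> w" using s by auto
  moreover have "b t \<le> b s" using staircase_antitone(1)[OF st, of s t] s by simp
  ultimately have "b t = 1" "d s = w" using size by auto
  then show "V \<in> tight_staircases w h"
    using st VH unfolding V tight_staircases_iff[OF h] \<open>s = 1\<close> \<open>t = h\<close> by blast
next
  fix V assume "V \<in> tight_staircases w h"
  then obtain b d where st: "staircase w h 1 h b d" and ends: "d 1 = w" "b h = 1"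
    and V: "V = staircase_vertices 1 h b d"
    using tight_staircases_iff[OF h] by blast
  obtain H where H: "H \<in> intervals w h" "verts H = staircase_vertices 1 h b d"
    using st by (rule interval_of_staircase)
  have "1 \<in> {1..h}" using h by simp
  then have "1 \<le> b 1 \<and> b 1 \<le> d 1" using st unfolding staircase_def by blast
  then have "interval_size H = (w, h)"
    using interval_size_staircase[OF st H(2)] ends h by simp
  then have "H \<in> R w h" using H(1) by (simp add: R_def)
  then show "V \<in> verts ` R w h" using H(2) V by (metis image_eqI)
qed

lemma card_R:
  assumes "1 \<le> h"
  shows "card (R w h) = card (tight_staircases w h)"
proof -
  have "inj_on verts (R w h)"
    using inj_on_verts_intervals by (rule inj_on_subset) (auto simp: R_def)
  then show ?thesis unfolding verts_image_R[OF assms, symmetric] by (rule card_image[symmetric])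
qed

lemma card_tight_staircases_narayana:
  assumes "1 \<le> w" "1 \<le> h"
  shows "real (card (tight_staircases w h)) = narayana (h + w - 1) h"
  using path_pairs_narayana[OF assms] card_tight_staircases[OF assms] by (metis of_int_of_nat_eq)

lemma narayana_symmetric_form:
  assumes "1 \<le> w" "1 \<le> h"
  shows "narayana (h + w - 1) h =
    1 / real (h + w - 1) * real ((h + w - 1) choose (h - 1)) * real ((h + w - 1) choose (w - 1))"
proof -
  have "(h + w - 1) choose h = (h + w - 1) choose (w - 1)"
    using binomial_symmetric[of h "h + w - 1"] assms by simp
  then show ?thesis by (simp add: narayana_def)
qed

theorem theorem4p11:
  fixes m n :: nat
  assumes "m \<ge> 1" and "n \<ge> 1"
  shows "(\<forall>w h. w \<ge> 1 \<longrightarrow> h \<ge> 1 \<longrightarrow>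
            real (card (R w h)) = narayana (h + w - 1) h \<and>
            narayana (h + w - 1) h =
              1 / real (h + w - 1) * real ((h + w - 1) choose (h - 1)) * real ((h + w - 1) choose (w - 1)))
       \<and> real (card (intervals m n)) =
            (\<Sum>w = 1..m. \<Sum>h = 1..n.
               (real m - real w + 1) * (real n - real h + 1) / real (h + w - 1)
               * real ((h + w - 1) choose (h - 1)) * real ((h + w - 1) choose (w - 1)))"
proof (intro conjI allI impI)
  fix w h :: nat
  assume wh: "w \<ge> 1" "h \<ge> 1"
  show "real (card (R w h)) = narayana (h + w - 1) h"
    using wh by (simp add: card_R card_tight_staircases_narayana)
  show "narayana (h + w - 1) h =
      1 / real (h + w - 1) * real ((h + w - 1) choose (h - 1)) * real ((h + w - 1) choose (w - 1))"
    using wh by (intro narayana_symmetric_form)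
next
  have "card (intervals m n) = card (staircase_sets m n)"
    unfolding verts_image_intervals[symmetric]
    by (rule card_image[symmetric]) (rule inj_on_verts_intervals)
  then have "real (card (intervals m n)) =
      (\<Sum>w = 1..m. \<Sum>h = 1..n.
         real (m - w + 1) * real (n - h + 1) * real (card (tight_staircases w h)))"
    by (simp only: card_staircase_sets of_nat_sum of_nat_mult)
  also have "\<dots> = (\<Sum>w = 1..m. \<Sum>h = 1..n.
      (real m - real w + 1) * (real n - real h + 1) / real (h + w - 1)
      * real ((h + w - 1) choose (h - 1)) * real ((h + w - 1) choose (w - 1)))"
  proof (intro sum.cong refl)
    fix w h assume "w \<in> {1..m}" "h \<in> {1..n}"
    then have wh: "1 \<le> w" "w \<le> m" "1 \<le> h" "h \<le> n" by auto
    then have "real (m - w + 1) = real m - real w + 1" "real (n - h + 1) = real n - real h + 1"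
      by (simp_all add: of_nat_diff)
    then show "real (m - w + 1) * real (n - h + 1) * real (card (tight_staircases w h)) =
      (real m - real w + 1) * (real n - real h + 1) / real (h + w - 1)
      * real ((h + w - 1) choose (h - 1)) * real ((h + w - 1) choose (w - 1))"
      using wh
      by (simp only: card_tight_staircases_narayana narayana_symmetric_form) simp
  qed
  finally show "real (card (intervals m n)) = (\<Sum>w = 1..m. \<Sum>h = 1..n.
      (real m - real w + 1) * (real n - real h + 1) / real (h + w - 1)
      * real ((h + w - 1) choose (h - 1)) * real ((h + w - 1) choose (w - 1)))" .
qed

end
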